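(* Let $a^0\in\mathbb{R}^m_{++}$, $\tau\ge 0$, $A\in\mathbb{R}^{m\times m}$ and $A^0=\operatorname{diag}(a^0)$. Let $S\subseteq\mathbb{R}^n$ be convex, and let $f:\mathbb{R}^m\times\mathbb{R}^n\to\mathbb{R}$ be convex with respect to its first variable $a$ and concave with respect to its second variable $x$. Then the robust optimal value $$f^*_{\rm robust}(\tau)=\max_{x\in S}\ \min_{a\in\Omega(a^0,\tau,A)}f(a,x)$$ satisfies $$m(\tau;x,u,v,s^1)\le f^*_{\rm robust}(\tau)\qquad\text{for all }(x,u,v,s^1)\in\mathcal{F},$$ where $$m(\tau;x,u,v,s^1)=\sum_{k=1}^m u_k\ln\left(1-\frac{a^0_kv_k}{u_k}\right)-\tau\|s^1\|_*-f^*(-v,x),$$ $$\mathcal{F}=\{(x,u,v,s^1)\in\mathbb{R}^n\times\mathbb{R}^m\times\mathbb{R}^m\times\mathbb{R}^m:\ x\in S,\ u=A^{\top}s^1,\ u\in\mathbb{R}^m_{++},\ u-A^0v\in\mathbb{R}^m_{++}\}.$$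
   Context: $\mathbb{R}^m_{++}$ is the set of vectors with all entries positive; $\|\cdot\|$ is an arbitrary norm on $\mathbb{R}^m$ and $\|\cdot\|_*$ its dual norm. The uncertainty set is $$\Omega(a^0,\tau,A)=\{a\in\mathbb{R}^m:\exists z,y\in\mathbb{R}^m,\ z_i>0,\ a=A^0z,\ z_i-\ln z_i-1\le y_i\ (i=1,\dots,m),\ \|Ay\|\le\tau\}.$$ $f^*(v,x)=\sup_{a\in\mathbb{R}^m}\{a^{\top}v-f(a,x)\}$ is the partial convex conjugate of $f$ with respect to its first variable. *)

theory Defs
  imports "HOL-Analysis.Analysis"
begin

text \<open>The ambient norm on \<open>\<real>\<^sup>m\<close> is arbitrary, so it is a parameter \<open>N\<close>, in general different from
  the Euclidean \<open>norm\<close> of the type.\<close>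

definition is_norm :: "('v::real_vector \<Rightarrow> real) \<Rightarrow> bool" where
  "is_norm N \<longleftrightarrow>
     (\<forall>x. 0 \<le> N x) \<and>
     (\<forall>x. N x = 0 \<longleftrightarrow> x = 0) \<and>
     (\<forall>c x. N (c *\<^sub>R x) = \<bar>c\<bar> * N x) \<and>
     (\<forall>x y. N (x + y) \<le> N x + N y)"

text \<open>For a norm \<open>N\<close> on a Euclidean space the unit ball is bounded, so this supremum of reals is
  taken over a nonempty set that is bounded above.\<close>

definition dual_norm :: "('v::euclidean_space \<Rightarrow> real) \<Rightarrow> 'v \<Rightarrow> real" where
  "dual_norm N s = (SUP y\<in>{y. N y \<le> 1}. s \<bullet> y)"

definition pos_orthant :: "(real^'m) set" where
  "pos_orthant = {v. \<forall>i. 0 < v $ i}"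

definition diag :: "real^'m \<Rightarrow> real^'m^'m" where
  "diag d = (\<chi> i j. if i = j then d $ i else 0)"

definition uncertainty_set ::
    "(real^'m \<Rightarrow> real) \<Rightarrow> real^'m \<Rightarrow> real \<Rightarrow> real^'m^'m \<Rightarrow> (real^'m) set" where
  "uncertainty_set N a0 \<tau> A =
     {a. \<exists>z y. (\<forall>i. 0 < z $ i) \<and> a = diag a0 *v z \<and>
               (\<forall>i. z $ i - ln (z $ i) - 1 \<le> y $ i) \<and> N (A *v y) \<le> \<tau>}"

text \<open>The conjugate may be \<open>\<infinity>\<close>; it is never \<open>-\<infinity>\<close> since \<open>f\<close> is real-valued.\<close>

definition partial_conjugate ::
    "(real^'m \<Rightarrow> real^'n \<Rightarrow> real) \<Rightarrow> real^'m \<Rightarrow> real^'n \<Rightarrow> ereal" where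
  "partial_conjugate f v x = (SUP a. ereal (a \<bullet> v - f a x))"

text \<open>Optimal values are extended reals: an unattained or unbounded optimum is the supremum or
  infimum, which agrees with the maximum or minimum whenever the latter exists.\<close>

definition robust_value ::
    "(real^'m \<Rightarrow> real) \<Rightarrow> (real^'n) set \<Rightarrow> (real^'m \<Rightarrow> real^'n \<Rightarrow> real) \<Rightarrow>
     real^'m \<Rightarrow> real \<Rightarrow> real^'m^'m \<Rightarrow> ereal" where
  "robust_value N S f a0 \<tau> A =
     (SUP x\<in>S. INF a\<in>uncertainty_set N a0 \<tau> A. ereal (f a x))"

text \<open>The minuend is finite, so no \<open>\<infinity> - \<infinity>\<close> occurs; the value is \<open>-\<infinity>\<close> exactly when the conjugate
  is \<open>\<infinity>\<close>.\<close>

definition lower_bound ::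
    "(real^'m \<Rightarrow> real) \<Rightarrow> (real^'m \<Rightarrow> real^'n \<Rightarrow> real) \<Rightarrow> real^'m \<Rightarrow> real \<Rightarrow>
     real^'n \<Rightarrow> real^'m \<Rightarrow> real^'m \<Rightarrow> real^'m \<Rightarrow> ereal" where
  "lower_bound N f a0 \<tau> x u v s =
     ereal ((\<Sum>k\<in>UNIV. u $ k * ln (1 - a0 $ k * v $ k / u $ k)) - \<tau> * dual_norm N s)
       - partial_conjugate f (- v) x"

definition feasible_set ::
    "(real^'n) set \<Rightarrow> real^'m \<Rightarrow> real^'m^'m \<Rightarrow> ((real^'n) \<times> (real^'m) \<times> (real^'m) \<times> (real^'m)) set" where
  "feasible_set S a0 A =
     {(x, u, v, s). x \<in> S \<and> u = transpose A *v s \<and> u \<in> pos_orthant \<and>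
                    u - diag a0 *v v \<in> pos_orthant}"

end

theory Submission
  imports Defs
begin

text \<open>
  The bound is weak duality: it is checked pointwise at each admissible \<open>a\<close>. Fix a feasible \<open>(x, u, v, s)\<close> and \<open>a = A\<^sup>0z\<close> in the uncertainty set with
  witness \<open>y\<close>.

  The Fenchel--Young inequality at the point \<open>a\<close> gives \<open>- f\<^sup>*(-v, x) \<le> f(a, x) + a \<bullet> v\<close>, so it
  remains to show
  \<open>(\<Sum>k. u\<^sub>k ln t\<^sub>k) + a \<bullet> v \<le> \<tau> \<parallel>s\<parallel>\<^sub>*\<close> where \<open>t\<^sub>k = 1 - a\<^sup>0\<^sub>kv\<^sub>k/u\<^sub>k\<close>, which is positive by
  feasibility. Since \<open>a\<^sub>kv\<^sub>k = u\<^sub>k (1 - t\<^sub>k) z\<^sub>k\<close>, the left-hand side is the sum of the terms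
  \<open>u\<^sub>k (ln t\<^sub>k + (1 - t\<^sub>k) z\<^sub>k)\<close>. The inequality \<open>ln w \<le> w - 1\<close> at \<open>w = t\<^sub>kz\<^sub>k\<close> bounds each of them by
  \<open>u\<^sub>k (z\<^sub>k - ln z\<^sub>k - 1) \<le> u\<^sub>ky\<^sub>k\<close> (\<open>entropy_term_le\<close>). Finally
  \<open>u \<bullet> y = A\<^sup>Ts \<bullet> y = s \<bullet> Ay \<le> \<parallel>s\<parallel>\<^sub>* \<parallel>Ay\<parallel> \<le> \<tau> \<parallel>s\<parallel>\<^sub>*\<close> by the generalized Cauchy--Schwarz
  inequality (\<open>inner_le_dual_norm\<close>). The latter rests on the unit ball of an arbitrary norm
  being bounded (\<open>is_norm_bounds_norm\<close>), as otherwise the supremum defining the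
  dual norm would carry no information.
\<close>

text \<open>A norm is convex, hence continuous in finite dimension; on the compact Euclidean unit
  sphere it attains a minimum, which is positive by definiteness, and homogeneity extends the
  bound to all vectors.\<close>

lemma is_norm_bounds_norm:
  fixes N :: "'v::euclidean_space \<Rightarrow> real"
  assumes "is_norm N"
  obtains c where "0 < c" "\<And>y. c * norm y \<le> N y"
proof -
  have scale: "N (r *\<^sub>R y) = \<bar>r\<bar> * N y" for r y
    using assms by (auto simp: is_norm_def)
  have triangle: "N (y + w) \<le> N y + N w" for y w
    using assms by (auto simp: is_norm_def)
  have pos: "0 < N y" if "y \<noteq> 0" for y
    using assms that by (metis is_norm_def less_eq_real_def)
  have "convex_on UNIV N"
  proof (rule convex_onI)
    fix t :: real and y w :: 'v
    assume "0 < t" "t < 1"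
    then show "N ((1 - t) *\<^sub>R y + t *\<^sub>R w) \<le> (1 - t) * N y + t * N w"
      using triangle[of "(1 - t) *\<^sub>R y" "t *\<^sub>R w"] by (simp add: scale)
  qed auto
  then have "continuous_on (sphere 0 1) N"
    using convex_on_continuous[of UNIV N] continuous_on_subset by blast
  moreover obtain b :: 'v where "b \<in> Basis"
    using nonempty_Basis by blast
  then have "sphere (0::'v) 1 \<noteq> {}"
    by (auto simp: dist_norm intro!: exI[of _ b])
  ultimately obtain p where p: "p \<in> sphere 0 1" "\<And>y. y \<in> sphere 0 1 \<Longrightarrow> N p \<le> N y"
    using continuous_attains_inf[of "sphere 0 1" N] compact_sphere by blast
  show thesis
  proof
    show "0 < N p"
      using p(1) by (intro pos) auto
    show "N p * norm y \<le> N y" for y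
    proof (cases "y = 0")
      case True
      then show ?thesis
        using scale[of 0 0] by simp
    next
      case False
      then have "N p \<le> N ((1 / norm y) *\<^sub>R y)"
        by (intro p(2)) simp
      with False show ?thesis
        by (simp add: scale field_simps)
    qed
  qed
qed

lemma bdd_above_inner_unit_ball:
  fixes N :: "'v::euclidean_space \<Rightarrow> real"
  assumes "is_norm N"
  shows "bdd_above ((\<lambda>y. s \<bullet> y) ` {y. N y \<le> 1})"
proof -
  obtain c where c: "0 < c" "\<And>y. c * norm y \<le> N y"
    using is_norm_bounds_norm[OF assms] by blast
  have "s \<bullet> y \<le> norm s * (1 / c)" if "N y \<le> 1" for y
  proof -
    have "norm y \<le> 1 / c"
      using c(1) order_trans[OF c(2)[of y] that] by (simp add: field_simps)
    then have "norm s * norm y \<le> norm s * (1 / c)"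
      by (intro mult_left_mono) auto
    then show ?thesis
      using norm_cauchy_schwarz[of s y] by linarith
  qed
  then show ?thesis
    by (intro bdd_aboveI2) auto
qed

lemma dual_norm_nonneg:
  fixes N :: "'v::euclidean_space \<Rightarrow> real"
  assumes "is_norm N"
  shows "0 \<le> dual_norm N s"
proof -
  have "N 0 = 0"
    using assms by (simp add: is_norm_def)
  then show ?thesis
    unfolding dual_norm_def
    by (intro cSUP_upper2[OF bdd_above_inner_unit_ball[OF assms], of 0]) auto
qed

lemma inner_le_dual_norm:
  fixes N :: "'v::euclidean_space \<Rightarrow> real"
  assumes "is_norm N"
  shows "s \<bullet> w \<le> dual_norm N s * N w"
proof (cases "w = 0")
  case True
  moreover have "N 0 = 0"
    using assms by (simp add: is_norm_def)
  ultimately show ?thesis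
    by simp
next
  case False
  then have pos: "0 < N w"
    using assms by (metis is_norm_def less_eq_real_def)
  have "N ((1 / N w) *\<^sub>R w) = \<bar>1 / N w\<bar> * N w"
    using assms unfolding is_norm_def by blast
  then have "N ((1 / N w) *\<^sub>R w) \<le> 1"
    using pos by simp
  then have "s \<bullet> ((1 / N w) *\<^sub>R w) \<le> dual_norm N s"
    unfolding dual_norm_def
    by (intro cSUP_upper bdd_above_inner_unit_ball[OF assms]) simp
  then show ?thesis
    using pos by (simp add: field_simps)
qed

lemma diag_mult_vec_nth [simp]: "(diag d *v w) $ i = d $ i * w $ i"
proof -
  have "(\<Sum>j\<in>UNIV. (if i = j then d $ i else 0) * w $ j)
      = (\<Sum>j\<in>UNIV. if i = j then d $ i * w $ j else 0)"
    by (intro sum.cong) auto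
  then show ?thesis
    by (simp add: diag_def matrix_vector_mult_def)
qed

text \<open>With \<open>t = 1 - b / u\<close> the claim, divided by \<open>u\<close>, is \<open>ln t + (1 - t) z \<le> z - ln z - 1\<close>,
  which is \<open>ln (t z) \<le> t z - 1\<close>. In other words, \<open>- u ln (1 - b / u)\<close> is the conjugate value
  at \<open>b\<close> of the convex function \<open>z \<mapsto> u (z - ln z - 1)\<close>.\<close>

lemma entropy_term_le:
  fixes u z b :: real
  assumes "0 < u" "0 < z" "b < u"
  shows "u * ln (1 - b / u) + b * z \<le> u * (z - ln z - 1)"
proof -
  define t where "t = 1 - b / u"
  have "0 < t" and b: "b = u * (1 - t)"
    using assms by (auto simp: t_def field_simps)
  then have "ln t + ln z \<le> t * z - 1"
    using ln_le_minus_one[of "t * z"] assms by (simp add: ln_mult)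
  then have "u * (ln t + (1 - t) * z) \<le> u * (z - ln z - 1)"
    using assms by (intro mult_left_mono) (auto simp: algebra_simps)
  then show ?thesis
    unfolding t_def[symmetric] by (simp add: b algebra_simps)
qed

text \<open>The expression \<open>\<tau> * dual_norm N s - (\<Sum>k. \<dots>)\<close> is thus an upper bound for the support
  function of the uncertainty set in direction \<open>v\<close>.\<close>

lemma uncertainty_set_inner_le:
  fixes N :: "real^'m \<Rightarrow> real"
  assumes "is_norm N"
    and a: "a \<in> uncertainty_set N a0 \<tau> A"
    and u: "u = transpose A *v s" "u \<in> pos_orthant" "u - diag a0 *v v \<in> pos_orthant"
  shows "(\<Sum>k\<in>UNIV. u $ k * ln (1 - a0 $ k * v $ k / u $ k)) + a \<bullet> v \<le> \<tau> * dual_norm N s"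
proof -
  obtain z y where z: "\<And>i. 0 < z $ i" and az: "a = diag a0 *v z"
    and y: "\<And>i. z $ i - ln (z $ i) - 1 \<le> y $ i" and Ay: "N (A *v y) \<le> \<tau>"
    using a unfolding uncertainty_set_def by blast
  have u_pos: "0 < u $ k" and less: "a0 $ k * v $ k < u $ k" for k
    using u(2,3) by (auto simp: pos_orthant_def)
  have term_le: "u $ k * ln (1 - a0 $ k * v $ k / u $ k) + a $ k * v $ k \<le> u $ k * y $ k" for k
  proof -
    have "u $ k * ln (1 - a0 $ k * v $ k / u $ k) + (a0 $ k * v $ k) * z $ k
        \<le> u $ k * (z $ k - ln (z $ k) - 1)"
      by (intro entropy_term_le u_pos z less)
    also have "\<dots> \<le> u $ k * y $ k"
      using u_pos[of k] y[of k] by (intro mult_left_mono) auto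
    finally show ?thesis
      by (simp add: az mult_ac)
  qed
  have "(\<Sum>k\<in>UNIV. u $ k * ln (1 - a0 $ k * v $ k / u $ k)) + a \<bullet> v
      = (\<Sum>k\<in>UNIV. u $ k * ln (1 - a0 $ k * v $ k / u $ k) + a $ k * v $ k)"
    by (simp add: inner_vec_def sum.distrib)
  also have "\<dots> \<le> u \<bullet> y"
    using sum_mono[OF term_le] by (simp add: inner_vec_def)
  also have "\<dots> = s \<bullet> (A *v y)"
    by (simp add: u(1) dot_lmul_matrix)
  also have "\<dots> \<le> dual_norm N s * N (A *v y)"
    by (rule inner_le_dual_norm[OF assms(1)])
  also have "\<dots> \<le> \<tau> * dual_norm N s"
    using mult_left_mono[OF Ay dual_norm_nonneg[OF assms(1)]] by (simp add: mult.commute)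
  finally show ?thesis .
qed

theorem theorem4p7:
  fixes N :: "real^'m \<Rightarrow> real"
    and a0 :: "real^'m" and \<tau> :: real and A :: "real^'m^'m"
    and S :: "(real^'n) set"
    and f :: "real^'m \<Rightarrow> real^'n \<Rightarrow> real"
  assumes "is_norm N"
    and "a0 \<in> pos_orthant"
    and "0 \<le> \<tau>"
    and "convex S"
    and "\<And>x. convex_on UNIV (\<lambda>a. f a x)"
    and "\<And>a. concave_on UNIV (\<lambda>x. f a x)"
  shows "\<forall>(x, u, v, s) \<in> feasible_set S a0 A.
           lower_bound N f a0 \<tau> x u v s \<le> robust_value N S f a0 \<tau> A"
proof (intro ballI, clarify)
  fix x u v s
  assume "(x, u, v, s) \<in> feasible_set S a0 A"
  then have x: "x \<in> S" and u: "u = transpose A *v s" "u \<in> pos_orthant" "u - diag a0 *v v \<in> pos_orthant"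
    by (auto simp: feasible_set_def)
  let ?c = "(\<Sum>k\<in>UNIV. u $ k * ln (1 - a0 $ k * v $ k / u $ k)) - \<tau> * dual_norm N s"
  have "lower_bound N f a0 \<tau> x u v s \<le> ereal (f a x)"
    if a: "a \<in> uncertainty_set N a0 \<tau> A" for a
  proof -
    have "ereal (a \<bullet> (- v) - f a x) \<le> partial_conjugate f (- v) x"
      unfolding partial_conjugate_def by (rule SUP_upper) simp
    then have "lower_bound N f a0 \<tau> x u v s \<le> ereal ?c - ereal (a \<bullet> (- v) - f a x)"
      unfolding lower_bound_def by (intro ereal_minus_mono) auto
    also have "\<dots> \<le> ereal (f a x)"
      using uncertainty_set_inner_le[OF assms(1) a u] by simp
    finally show ?thesis .
  qed
  then have "lower_bound N f a0 \<tau> x u v s \<le> (INF a\<in>uncertainty_set N a0 \<tau> A. ereal (f a x))"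
    by (intro INF_greatest)
  also have "\<dots> \<le> robust_value N S f a0 \<tau> A"
    unfolding robust_value_def using x by (intro SUP_upper)
  finally show "lower_bound N f a0 \<tau> x u v s \<le> robust_value N S f a0 \<tau> A" .
qed

end
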